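(* Let $H$ be a connected graph with $n$ vertices and $m$ edges. Let $p\ge 3$ be a prime. Then $s_p(H)\le \frac{3p-1}{2}m-\frac{p-1}{2}n+\frac{p+1}{2}$.
   Context: Graphs are finite and simple. $\mathbb{Z}_q$ denotes the cyclic group of order $q$. A $\mathbb{Z}_q$-edge-weighted $K_f$ is the complete graph $K_f$ on $f$ vertices equipped with a weight function $\omega:E(K_f)\to\mathbb{Z}_q$ (arbitrary). The weight of a path is the sum in $\mathbb{Z}_q$ of the weights of its edges. A subdivision of a graph $H$ is a graph obtained from $H$ by replacing each edge of $H$ by a path (a subdivision path) of length at least $1$ with the same endpoints, where the internal vertices of these paths are new and the paths are pairwise internally disjoint. A $q$-divisible subdivision of $H$ in a $\mathbb{Z}_q$-edge-weighted $K_f$ is a subgraph of $K_f$ that is a subdivision of $H$ in which every subdivision path has weight $0$ in $\mathbb{Z}_q$. For an integer $q\ge 2$, $s_q(H)$ denotes the minimum $f$ such that every $\mathbb{Z}_q$-edge-weighted $K_f$ contains a $q$-divisible subdivision of $H$. *)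

theory Defs
  imports
    "HOL-Library.FuncSet"
    "HOL-Library.Extended_Real"
    "HOL-Computational_Algebra.Primes"
    "HOL-Algebra.FiniteProduct"
    "HOL-Algebra.Elementary_Groups"
begin

record 'a ugraph =
  verts :: "'a set"
  edges :: "'a set set"

definition simple_graph :: "'a ugraph \<Rightarrow> bool" where
  "simple_graph G \<longleftrightarrow>
     finite (verts G) \<and>
     (\<forall>e\<in>edges G. \<exists>u\<in>verts G. \<exists>v\<in>verts G. u \<noteq> v \<and> e = {u, v})"

definition subgraph_of :: "'a ugraph \<Rightarrow> 'a ugraph \<Rightarrow> bool" where
  "subgraph_of S G \<longleftrightarrow> verts S \<subseteq> verts G \<and> edges S \<subseteq> edges G"

text \<open>A path is given by the list of its vertices; \<open>path_edges xs\<close> is its set of edges.\<close>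

definition path_edges :: "'a list \<Rightarrow> 'a set set" where
  "path_edges xs = {{xs ! i, xs ! Suc i} | i. Suc i < length xs}"

definition path_inner :: "'a list \<Rightarrow> 'a set" where
  "path_inner xs = set (butlast (tl xs))"

definition path_in :: "'a ugraph \<Rightarrow> 'a list \<Rightarrow> bool" where
  "path_in G xs \<longleftrightarrow>
     xs \<noteq> [] \<and> distinct xs \<and> set xs \<subseteq> verts G \<and> path_edges xs \<subseteq> edges G"

text \<open>As usual, the graph without vertices is not regarded as connected.\<close>

definition connected_graph :: "'a ugraph \<Rightarrow> bool" where
  "connected_graph G \<longleftrightarrow>
     verts G \<noteq> {} \<and>
     (\<forall>u\<in>verts G. \<forall>v\<in>verts G. \<exists>xs. path_in G xs \<and> hd xs = u \<and> last xs = v)"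

definition K :: "nat \<Rightarrow> nat ugraph" where
  "K f = \<lparr>verts = {..<f}, edges = {{u, v} | u v. u < f \<and> v < f \<and> u \<noteq> v}\<rparr>"

text \<open>
  \<open>S\<close> is the subdivision of \<open>H\<close> whose branch vertices are given by \<open>\<phi>\<close> and in which the edge
  \<open>e\<close> of \<open>H\<close> is replaced by the path \<open>P e\<close>, of length at least 1, i.e. with at least 2 vertices.
  The orientation in which \<open>P e\<close> lists its vertices is irrelevant.
\<close>

definition subdivision_via ::
  "'a ugraph \<Rightarrow> 'b ugraph \<Rightarrow> ('a \<Rightarrow> 'b) \<Rightarrow> ('a set \<Rightarrow> 'b list) \<Rightarrow> bool" where
  "subdivision_via H S \<phi> P \<longleftrightarrow>
     inj_on \<phi> (verts H) \<and>
     (\<forall>e\<in>edges H.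
        2 \<le> length (P e) \<and> distinct (P e) \<and> {hd (P e), last (P e)} = \<phi> ` e \<and>
        path_inner (P e) \<inter> \<phi> ` verts H = {}) \<and>
     (\<forall>e\<in>edges H. \<forall>e'\<in>edges H. e \<noteq> e' \<longrightarrow> path_inner (P e) \<inter> path_inner (P e') = {}) \<and>
     verts S = \<phi> ` verts H \<union> (\<Union>e\<in>edges H. set (P e)) \<and>
     edges S = (\<Union>e\<in>edges H. path_edges (P e))"

text \<open>
  The sum of the weights along a path, in the cyclic group of order \<open>q\<close>.  HOL-Algebra writes
  the product \<open>finprod\<close> of a commutative group multiplicatively; here it is addition modulo \<open>q\<close>.
\<close>

definition path_weight :: "nat \<Rightarrow> ('a set \<Rightarrow> int) \<Rightarrow> 'a list \<Rightarrow> int" where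
  "path_weight q \<omega> xs = finprod (integer_mod_group q) \<omega> (path_edges xs)"

definition divisible_subdivision ::
  "nat \<Rightarrow> 'a ugraph \<Rightarrow> ('b set \<Rightarrow> int) \<Rightarrow> 'b ugraph \<Rightarrow> bool" where
  "divisible_subdivision q H \<omega> S \<longleftrightarrow>
     (\<exists>\<phi> P. subdivision_via H S \<phi> P \<and> (\<forall>e\<in>edges H. path_weight q \<omega> (P e) = 0))"

definition forces_divisible_subdivision :: "nat \<Rightarrow> 'a ugraph \<Rightarrow> nat \<Rightarrow> bool" where
  "forces_divisible_subdivision q H f \<longleftrightarrow>
     (\<forall>\<omega> \<in> edges (K f) \<rightarrow> carrier (integer_mod_group q).
        \<exists>S. subgraph_of S (K f) \<and> divisible_subdivision q H \<omega> S)"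

text \<open>
  The minimum is taken in the extended naturals, so that its value is \<open>\<infinity>\<close> if no \<open>f\<close> qualifies;
  an upper bound by a real number thus includes the existence of the minimum.
\<close>

definition s_q :: "nat \<Rightarrow> 'a ugraph \<Rightarrow> enat" where
  "s_q q H = (INF f \<in> {f. forces_divisible_subdivision q H f}. enat f)"

lemma s_q_eq_Least:
  assumes "\<exists>f. forces_divisible_subdivision q H f"
  shows "s_q q H = enat (LEAST f. forces_divisible_subdivision q H f)"
proof -
  let ?F = "forces_divisible_subdivision q H"
  have "?F (LEAST f. ?F f)"
    using assms by (rule LeastI_ex)
  then show ?thesis
    unfolding s_q_def by (intro antisym INF_lower INF_greatest) (auto intro: Least_le)
qed

lemma path_weight_eq_sum_mod:
  assumes "\<omega> \<in> path_edges xs \<rightarrow> carrier (integer_mod_group q)"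
  shows "path_weight q \<omega> xs = (\<Sum>e\<in>path_edges xs. \<omega> e) mod int q"
proof -
  interpret comm_group "integer_mod_group q" by simp
  have "finprod (integer_mod_group q) \<omega> A = (\<Sum>e\<in>A. \<omega> e) mod int q"
    if "finite A" "\<omega> \<in> A \<rightarrow> carrier (integer_mod_group q)" for A
    using that by (induction A) (auto simp: mod_add_right_eq)
  moreover have "finite (path_edges xs)"
    unfolding path_edges_def by (rule finite_image_set) (rule finite_subset[of _ "{..<length xs}"], auto)
  ultimately show ?thesis
    unfolding path_weight_def using assms by blast
qed

end

theory Submission
  imports Defs "HOL-Number_Theory.Cong"
begin

text \<open>
  Write \<open>p = 2 * c + 1\<close>.  The bound is additive over a way of building \<open>H\<close>: start with one
  vertex (value 1), pay \<open>p\<close> for each pendant edge to a new vertex and \<open>p + c = (3 * p - 1) / 2\<close>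
  for each edge between two vertices that are already there.  A connected graph with \<open>n\<close> vertices
  and \<open>m\<close> edges uses \<open>n - 1\<close> steps of the first kind and \<open>m - n + 1\<close> of the second
  (\<open>connected_graph_induct\<close>, \<open>connected_graph_forces\<close>).  So it remains to justify the two prices,
  for arbitrary weights on an arbitrary finite vertex set \<open>V\<close>.

  \<^bold>\<open>Pendant edge at \<open>u\<close>\<close> (\<open>forces_add_leaf\<close>).  With \<open>p\<close> spare vertices one can find, one after the
  other, \<open>p + 1\<close> copies of a subdivision of the smaller graph, each avoiding the images of \<open>u\<close> in
  the earlier copies.  String these \<open>p + 1\<close> images of \<open>u\<close> together to a path.  By the pigeonhole
  principle on partial sums, a segment of it has weight 0.  Its later end is the image of \<open>u\<close> in a
  copy that avoids the rest of the segment, so the segment can be attached there.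

  \<^bold>\<open>Edge between \<open>u\<close> and \<open>v\<close>\<close> (\<open>forces_add_edge\<close>).  A set of \<open>3 * k + 1\<close> vertices is grown in which
  paths between two fixed ends have at least \<open>min p (2 * k + 1)\<close> residues.  It can be continued at
  its end \<open>y\<close> by vertices \<open>b, c, d\<close> whenever the paths from \<open>y\<close> to \<open>d\<close> inside \<open>{y, b, c, d}\<close> have
  three residues, by the Cauchy-Davenport theorem.  If this works up to \<open>k = c\<close>, all residues are
  available on \<open>(3 * p - 1) / 2\<close> vertices; then the smaller graph is embedded outside of this set, and
  the images of \<open>u\<close> and \<open>v\<close> are joined through it by a path of weight 0.

  If the growth stops earlier, the remaining set \<open>R\<close> is \<^emph>\<open>flat\<close> at \<open>y\<close>: no choice of \<open>b, c, d\<close> gives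
  three residues.  Then the edges of nonzero weight in \<open>R\<close> form a matching or a complete bipartite
  graph (\<open>flat_triangle\<close>), so half of \<open>R\<close> spans only edges of weight 0
  (\<open>flat_zero_clique\<close>).  As \<open>R\<close> is large, the new graph embeds there with every edge as its own
  subdivision path.
\<close>

section \<open>Sumsets modulo a prime\<close>

lemma inj_on_shift_mod: "inj_on (\<lambda>x. (x + e) mod int p) {0..<int p}"
proof (rule inj_onI)
  fix x y assume "x \<in> {0..<int p}" "y \<in> {0..<int p}" "(x + e) mod int p = (y + e) mod int p"
  then have "x mod int p = y mod int p"
    by (metis cong_add_rcancel cong_def)
  with \<open>x \<in> _\<close> \<open>y \<in> _\<close> show "x = y" by simp
qed

abbreviation sumset_mod :: "nat \<Rightarrow> int set \<Rightarrow> int set \<Rightarrow> int set" where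
  "sumset_mod p A B \<equiv> (\<lambda>(a, b). (a + b) mod int p) ` (A \<times> B)"

text \<open>
  A nonzero residue generates the group of order \<open>p\<close>, so the orbit of any element under repeated
  addition of \<open>d\<close> is everything.
\<close>

lemma shift_closed_imp_all_residues:
  assumes "prime p" "A \<subseteq> {0..<int p}" "A \<noteq> {}" "\<not> int p dvd d"
    and closed: "\<And>a. a \<in> A \<Longrightarrow> (a + d) mod int p \<in> A"
  shows "A = {0..<int p}"
proof
  obtain a where a: "a \<in> A" using assms(3) by blast
  have p0: "int p > 0" using assms(1) by (simp add: prime_gt_0_nat)
  have iter: "(a + int k * d) mod int p \<in> A" for k
  proof (induction k)
    case 0
    then show ?case using a assms(2) by auto
  next
    case (Suc k)
    from closed[OF this] show ?case by (simp add: mod_simps algebra_simps)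
  qed
  have "coprime d (int p)"
    using assms(1,4) by (metis coprime_commute prime_imp_coprime prime_nat_int_transfer)
  then obtain x where x: "[d * x = 1] (mod int p)"
    using cong_solve_coprime_int by blast
  show "{0..<int p} \<subseteq> A"
  proof
    fix t assume t: "t \<in> {0..<int p}"
    define k where "k = nat ((x * (t - a)) mod int p)"
    have "int k = (x * (t - a)) mod int p" using p0 by (simp add: k_def)
    then have "(a + int k * d) mod int p = (a + (d * x) * (t - a)) mod int p"
      by (metis mod_add_right_eq mod_mult_right_eq mult.assoc mult.commute)
    also have "\<dots> = (a + 1 * (t - a)) mod int p"
      using x by (metis cong_add_lcancel cong_def cong_scalar_right)
    also have "\<dots> = t" using t by simp
    finally show "t \<in> A" using iter[of k] by simp
  qed
qed (use assms in auto)

text \<open>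
  Induction on the size of \<open>B\<close>, with Dyson's transform for a shift \<open>e\<close>: move to \<open>A\<close> those elements of
  \<open>B + e\<close> that it lacks, and delete their preimages from \<open>B\<close>.  This keeps the sum of the sizes and
  does not enlarge the sumset.  Some shift \<open>e = a - b\<close> makes \<open>B\<close> smaller without emptying it, unless
  \<open>A\<close> is closed under all differences of elements of \<open>B\<close>, and then \<open>A\<close> is everything or \<open>B\<close> is
  a singleton.
\<close>

theorem Cauchy_Davenport:
  assumes "prime p" "A \<noteq> {}" "B \<noteq> {}" "A \<subseteq> {0..<int p}" "B \<subseteq> {0..<int p}"
  shows "min p (card A + card B - 1) \<le> card (sumset_mod p A B)"
  using assms(2-)
proof (induction "card B" arbitrary: A B rule: less_induct)
  case less
  let ?sh = "\<lambda>e x. (x + e) mod int p"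
  have fin: "finite A" "finite B" using less.prems by (auto intro: finite_subset)
  have card_shift: "card (?sh e ` S) = card S" if "S \<subseteq> {0..<int p}" for e S
    by (rule card_image) (use inj_on_shift_mod that in \<open>blast intro: inj_on_subset\<close>)
  have p0: "int p > 0" using assms(1) by (simp add: prime_gt_0_nat)
  show ?case
  proof (cases "\<forall>a\<in>A. \<forall>b\<in>B. \<forall>b'\<in>B. (a + (b' - b)) mod int p \<in> A")
    case stable: True
    obtain b where b: "b \<in> B" using less.prems by blast
    have "?sh b ` A \<subseteq> sumset_mod p A B" using b by auto
    then have "card (?sh b ` A) \<le> card (sumset_mod p A B)"
      using fin by (intro card_mono) auto
    then have le: "card A \<le> card (sumset_mod p A B)"
      using card_shift[of A b] less.prems by simp
    show ?thesis
    proof (cases "B = {b}")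
      case True
      then show ?thesis using le by simp
    next
      case False
      then obtain b' where b': "b' \<in> B" "b' \<noteq> b" using b by blast
      have "\<not> int p dvd b' - b"
      proof
        assume "int p dvd b' - b"
        then have "b' mod int p = b mod int p" by (simp add: mod_eq_dvd_iff)
        then show False using b b' less.prems(4) by (metis atLeastLessThan_iff mod_pos_pos_trivial subsetD)
      qed
      then have "A = {0..<int p}"
        using shift_closed_imp_all_residues[OF assms(1) less.prems(3) less.prems(1), of "b' - b"]
          stable b b'(1) by simp
      then show ?thesis using le by simp
    qed
  next
    case False
    then obtain a b b' where abb: "a \<in> A" "b \<in> B" "b' \<in> B" "(a + (b' - b)) mod int p \<notin> A"
      by blast
    define e where "e = a - b"
    define B' where "B' = {y \<in> B. ?sh e y \<in> A}"
    define A' where "A' = A \<union> ?sh e ` (B - B')"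
    have "b \<in> B'" using abb less.prems(3) by (auto simp: B'_def e_def)
    have "b' \<in> B - B'" using abb by (auto simp: B'_def e_def algebra_simps)
    have "card B' < card B"
      using \<open>b' \<in> B - B'\<close> fin by (intro psubset_card_mono) (auto simp: B'_def)
    moreover have "A' \<subseteq> {0..<int p}" using less.prems p0 by (auto simp: A'_def)
    moreover have "B' \<subseteq> {0..<int p}" using less.prems by (auto simp: B'_def)
    ultimately have IH: "min p (card A' + card B' - 1) \<le> card (sumset_mod p A' B')"
      using less.hyps[of B' A'] \<open>b \<in> B'\<close> abb by (auto simp: A'_def)
    have "A \<inter> ?sh e ` (B - B') = {}" by (auto simp: B'_def)
    then have "card A' = card A + card (B - B')"
      unfolding A'_def using fin card_shift[of "B - B'" e] less.prems(4)
      by (subst card_Un_disjoint) auto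
    moreover have "card (B - B') + card B' = card B"
      using fin by (metis (no_types, lifting) B'_def Collect_subset add.commute card_Diff_subset
          card_mono finite_subset le_add_diff_inverse mem_Collect_eq subsetI)
    ultimately have sizes: "card A' + card B' = card A + card B" by simp
    have "sumset_mod p A' B' \<subseteq> sumset_mod p A B"
    proof
      fix s assume "s \<in> sumset_mod p A' B'"
      then obtain x z where xz: "x \<in> A'" "z \<in> B'" "s = (x + z) mod int p" by auto
      show "s \<in> sumset_mod p A B"
      proof (cases "x \<in> A")
        case True
        then show ?thesis using xz by (auto simp: B'_def)
      next
        case False
        then obtain y where y: "y \<in> B" "x = ?sh e y" using xz by (auto simp: A'_def)
        have "s = (?sh e z + y) mod int p" using xz y by (simp add: mod_simps algebra_simps)
        then show ?thesis using y xz by (auto simp: B'_def)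
      qed
    qed
    then have "card (sumset_mod p A' B') \<le> card (sumset_mod p A B)"
      using fin by (intro card_mono) auto
    then show ?thesis using IH sizes by simp
  qed
qed

section \<open>Weights of paths\<close>

text \<open>
  The weight of a vertex list, by recursion along the list and as an integer: congruences modulo \<open>p\<close>
  are taken only where they are needed, and weights need not be reduced.
\<close>

fun wt :: "('b set \<Rightarrow> int) \<Rightarrow> 'b list \<Rightarrow> int" where
  "wt w (x # y # xs) = w {x, y} + wt w (y # xs)"
| "wt w [x] = 0"
| "wt w [] = 0"

lemma wt_append_Cons: "wt w (xs @ x # ys) = wt w (xs @ [x]) + wt w (x # ys)"
  by (induction w xs rule: wt.induct) auto

lemma wt_append_tl:
  assumes "xs \<noteq> []" "ys \<noteq> []" "last xs = hd ys"
  shows "wt w (xs @ tl ys) = wt w xs + wt w ys"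
proof -
  have "xs @ tl ys = butlast xs @ last xs # tl ys"
    using assms(1) by (metis append.assoc append_Cons append_Nil append_butlast_last_id)
  also have "wt w \<dots> = wt w xs + wt w ys"
    using assms by (subst wt_append_Cons) (metis append_butlast_last_id list.collapse)
  finally show ?thesis .
qed

lemma path_edges_Cons: "path_edges (x # y # xs) = insert {x, y} (path_edges (y # xs))"
proof -
  have "{i. Suc i < length (x # y # xs)} = insert 0 (Suc ` {i. Suc i < length (y # xs)})"
  proof -
    have "i \<in> insert 0 (Suc ` {i. Suc i < length (y # xs)})" if "Suc i < length (x # y # xs)" for i
      using that by (cases i) auto
    then show ?thesis by auto
  qed
  moreover have "path_edges zs = (\<lambda>i. {zs ! i, zs ! Suc i}) ` {i. Suc i < length zs}" for zs :: "'a list"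
    by (auto simp: path_edges_def)
  ultimately show ?thesis by (simp add: image_image)
qed

lemma path_edges_single: "path_edges [x] = {}" "path_edges [] = {}"
  by (auto simp: path_edges_def)

lemma finite_path_edges: "finite (path_edges xs)"
  by (induction xs rule: induct_list012) (auto simp: path_edges_Cons path_edges_single)

lemma path_edges_doubleton: "e \<in> path_edges xs \<Longrightarrow> distinct xs \<Longrightarrow> \<exists>u\<in>set xs. \<exists>v\<in>set xs. u \<noteq> v \<and> e = {u, v}"
  by (induction xs rule: induct_list012) (auto simp: path_edges_Cons path_edges_single)

lemma sum_path_edges: "distinct xs \<Longrightarrow> (\<Sum>e\<in>path_edges xs. w e) = wt w xs"
proof (induction xs rule: induct_list012)
  case (3 x y zs)
  have "{x, y} \<notin> path_edges (y # zs)"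
    using path_edges_doubleton[of "{x, y}" "y # zs"] 3(3) by (auto simp: doubleton_eq_iff)
  then show ?case using 3 by (simp add: path_edges_Cons finite_path_edges)
qed (auto simp: path_edges_single)

text \<open>
  Among the weights of the \<open>p + 1\<close> longest suffixes two are congruent; their difference is the weight
  of a segment.
\<close>

lemma zero_weight_segment:
  assumes "p > 0" "p < length xs"
  obtains A x B y C where "xs = A @ x # B @ y # C" "int p dvd wt w (x # B @ [y])"
proof -
  let ?f = "\<lambda>i. wt w (drop i xs) mod int p"
  have "?f ` {..p} \<subseteq> {0..<int p}" using assms by auto
  then have "card (?f ` {..p}) \<le> card {0..<int p}" by (intro card_mono) auto
  then have "\<not> inj_on ?f {..p}" using card_image[of ?f "{..p}"] by auto
  then obtain i j where ij: "i < j" "j \<le> p" "?f i = ?f j"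
    unfolding inj_on_def by (metis atMost_iff linorder_neqE_nat)
  define B where "B = take (j - Suc i) (drop (Suc i) xs)"
  have i: "drop i xs = xs ! i # drop (Suc i) xs" using ij assms by (simp add: Cons_nth_drop_Suc)
  have j: "drop j xs = xs ! j # drop (Suc j) xs" using ij assms by (simp add: Cons_nth_drop_Suc)
  have "drop (Suc i) xs = B @ drop j xs"
    unfolding B_def using ij(1) by (metis Suc_leI append_take_drop_id drop_drop le_add_diff_inverse2)
  then have dec: "drop i xs = xs ! i # B @ xs ! j # drop (Suc j) xs" using i j by simp
  then have "wt w (drop i xs) = wt w (xs ! i # B @ [xs ! j]) + wt w (drop j xs)"
    using wt_append_Cons[of w "xs ! i # B" "xs ! j" "drop (Suc j) xs"] j by simp
  moreover have "int p dvd wt w (drop i xs) - wt w (drop j xs)"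
    using ij(3) by (simp add: mod_eq_dvd_iff)
  ultimately have "int p dvd wt w (xs ! i # B @ [xs ! j])" by simp
  moreover have "xs = take i xs @ xs ! i # B @ xs ! j # drop (Suc j) xs"
    using dec by (metis append_take_drop_id)
  ultimately show thesis using that by blast
qed

section \<open>Embedded zero-weight subdivisions\<close>

text \<open>
  The data of a subdivision of \<open>H\<close> inside the complete graph on \<open>V\<close>, with the weight condition added.
  In contrast to a subgraph of some \<open>K f\<close>, the vertex set is arbitrary; the inductive steps pass to
  subsets of \<open>V\<close>.
\<close>

definition zero_subdivision ::
  "nat \<Rightarrow> ('b set \<Rightarrow> int) \<Rightarrow> 'b set \<Rightarrow> 'a ugraph \<Rightarrow> ('a \<Rightarrow> 'b) \<Rightarrow> ('a set \<Rightarrow> 'b list) \<Rightarrow> bool" where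
  "zero_subdivision p w V H \<phi> P \<longleftrightarrow>
     inj_on \<phi> (verts H) \<and> \<phi> ` verts H \<subseteq> V \<and>
     (\<forall>e\<in>edges H.
        2 \<le> length (P e) \<and> distinct (P e) \<and> {hd (P e), last (P e)} = \<phi> ` e \<and>
        path_inner (P e) \<inter> \<phi> ` verts H = {} \<and> set (P e) \<subseteq> V \<and> int p dvd wt w (P e)) \<and>
     (\<forall>e\<in>edges H. \<forall>e'\<in>edges H. e \<noteq> e' \<longrightarrow> path_inner (P e) \<inter> path_inner (P e') = {})"

text \<open>
  Only a lower bound on the size of \<open>V\<close> is asked for, which makes the property monotone in \<open>f\<close> and
  lets it be applied to whatever is left after some vertices have been set aside.
\<close>

definition forces_zero_subdivision :: "nat \<Rightarrow> 'b itself \<Rightarrow> 'a ugraph \<Rightarrow> nat \<Rightarrow> bool" where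
  "forces_zero_subdivision p (_ :: 'b itself) H f \<longleftrightarrow>
     (\<forall>(V :: 'b set) w. finite V \<longrightarrow> f \<le> card V \<longrightarrow> (\<exists>\<phi> P. zero_subdivision p w V H \<phi> P))"

abbreviation add_vertex :: "'a \<Rightarrow> 'a ugraph \<Rightarrow> 'a ugraph" where
  "add_vertex v G \<equiv> \<lparr>verts = insert v (verts G), edges = edges G\<rparr>"

abbreviation add_edge :: "'a \<Rightarrow> 'a \<Rightarrow> 'a ugraph \<Rightarrow> 'a ugraph" where
  "add_edge u v G \<equiv> \<lparr>verts = verts G, edges = insert {u, v} (edges G)\<rparr>"

lemma path_inner_subset: "path_inner xs \<subseteq> set xs"
  by (cases xs) (auto simp: path_inner_def dest: in_set_butlastD)

lemma path_inner_bracket [simp]: "path_inner (x # B @ [y]) = set B"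
  by (simp add: path_inner_def)

lemma simple_graph_add_vertex: "simple_graph G \<Longrightarrow> simple_graph (add_vertex v G)"
  unfolding simple_graph_def ugraph.simps by (metis finite_insert insertCI)

lemma zero_subdivision_mono:
  assumes "zero_subdivision p w U G \<phi> P" "U \<subseteq> V"
  shows "zero_subdivision p w V G \<phi> P"
  using assms unfolding zero_subdivision_def by (simp add: subset_trans[OF _ assms(2)])

text \<open>
  An isolated vertex is placed on a vertex that the given subdivision does not touch.  Together with
  the next lemma this also handles pendant edges.
\<close>

lemma zero_subdivision_add_vertex:
  assumes emb: "zero_subdivision p w V G \<phi> P"
    and G: "simple_graph G" and v: "v \<notin> verts G" and y: "y \<notin> V"
  shows "zero_subdivision p w (insert y V) (add_vertex v G) (\<phi>(v := y)) P"
proof -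
  have img: "(\<phi>(v := y)) ` S = \<phi> ` S" if "S \<subseteq> verts G" for S
    using v that by (intro image_cong) auto
  have e: "e \<subseteq> verts G" if "e \<in> edges G" for e
    using G that unfolding simple_graph_def by auto
  have inj: "inj_on (\<phi>(v := y)) (insert v (verts G))"
    using emb y v by (auto simp: zero_subdivision_def inj_on_def)
  have verts: "(\<phi>(v := y)) ` insert v (verts G) = insert y (\<phi> ` verts G)"
    using img[of "verts G"] by auto
  have "path_inner (P e) \<inter> insert y (\<phi> ` verts G) = {} \<and> (\<phi>(v := y)) ` e = \<phi> ` e \<and> set (P e) \<subseteq> insert y V"
    if "e \<in> edges G" for e
  proof -
    have "set (P e) \<subseteq> V" "path_inner (P e) \<inter> \<phi> ` verts G = {}"
      using emb that by (simp_all add: zero_subdivision_def)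
    then show ?thesis using y path_inner_subset[of "P e"] img[OF e[OF that]] by auto
  qed
  moreover have "insert y (\<phi> ` verts G) \<subseteq> insert y V"
    using emb by (auto simp: zero_subdivision_def)
  ultimately show ?thesis
    using emb inj unfolding zero_subdivision_def ugraph.simps verts by simp
qed

lemma zero_subdivision_add_edge:
  assumes emb: "zero_subdivision p w U G \<phi> P"
    and G: "simple_graph G" and uv: "u \<in> verts G" "v \<in> verts G"
    and Q: "distinct (\<phi> u # B @ [\<phi> v])" "int p dvd wt w (\<phi> u # B @ [\<phi> v])" "set B \<inter> U = {}"
    and V: "set B \<subseteq> V" "U \<subseteq> V"
  shows "\<exists>P'. zero_subdivision p w V (add_edge u v G) \<phi> P'"
proof (cases "{u, v} \<in> edges G")
  case True
  then have "add_edge u v G = G" by (simp add: insert_absorb)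
  with zero_subdivision_mono[OF emb V(2)] show ?thesis by metis
next
  case False
  let ?P = "P({u, v} := \<phi> u # B @ [\<phi> v])"
  have *: "zero_subdivision p w V (add_edge u v G) \<phi> ?P"
    unfolding zero_subdivision_def ugraph.simps
  proof (intro conjI ballI impI)
    show "inj_on \<phi> (verts G)" "\<phi> ` verts G \<subseteq> V"
      using emb V by (auto simp: zero_subdivision_def)
  next
    fix e assume "e \<in> insert {u, v} (edges G)"
    then consider "e = {u, v}" | "e \<in> edges G" "e \<noteq> {u, v}" by blast
    then have "2 \<le> length (?P e) \<and> distinct (?P e) \<and> {hd (?P e), last (?P e)} = \<phi> ` e \<and>
        path_inner (?P e) \<inter> \<phi> ` verts G = {} \<and> set (?P e) \<subseteq> V \<and> int p dvd wt w (?P e)"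
    proof cases
      case 1
      have "\<phi> u \<in> V" "\<phi> v \<in> V" "\<phi> ` verts G \<subseteq> U" using emb uv V by (auto simp: zero_subdivision_def)
      then show ?thesis using Q V 1 by (auto simp del: wt.simps)
    next
      case 2
      then have "?P e = P e" by simp
      then show ?thesis
        using zero_subdivision_mono[OF emb V(2)] 2 by (simp add: zero_subdivision_def)
    qed
    then show "2 \<le> length (?P e)" "distinct (?P e)" "{hd (?P e), last (?P e)} = \<phi> ` e"
      "path_inner (?P e) \<inter> \<phi> ` verts G = {}" "set (?P e) \<subseteq> V" "int p dvd wt w (?P e)" by blast+
  next
    fix e e' assume ee: "e \<in> insert {u, v} (edges G)" "e' \<in> insert {u, v} (edges G)" "e \<noteq> e'"
    have B: "path_inner (P d) \<inter> set B = {}" if "d \<in> edges G" for d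
    proof -
      have "set (P d) \<subseteq> U" using emb that by (simp add: zero_subdivision_def)
      then show ?thesis using Q(3) path_inner_subset[of "P d"] by blast
    qed
    show "path_inner (?P e) \<inter> path_inner (?P e') = {}"
    proof (cases "e = {u, v} \<or> e' = {u, v}")
      case True
      with ee B show ?thesis by (auto simp: Int_commute)
    next
      case False
      with ee emb show ?thesis by (simp add: zero_subdivision_def)
    qed
  qed
  then show ?thesis by blast
qed

lemma zero_subdivision_of_zero_clique:
  assumes G: "simple_graph G" and "finite I" "card (verts G) \<le> card I" "I \<subseteq> V"
    and zero: "\<And>a b. a \<in> I \<Longrightarrow> b \<in> I \<Longrightarrow> a \<noteq> b \<Longrightarrow> int p dvd w {a, b}"
  shows "\<exists>\<phi> P. zero_subdivision p w V G \<phi> P"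
proof -
  obtain \<phi> where phi: "\<phi> ` verts G \<subseteq> I" "inj_on \<phi> (verts G)"
    using G assms(2,3) unfolding simple_graph_def by (meson card_le_inj)
  have "\<exists>xs. distinct xs \<and> length xs = 2 \<and> {hd xs, last xs} = \<phi> ` e \<and> path_inner xs = {} \<and>
      set xs \<subseteq> V \<and> int p dvd wt w xs" if "e \<in> edges G" for e
  proof -
    obtain u v where uv: "u \<in> verts G" "v \<in> verts G" "u \<noteq> v" "e = {u, v}"
      using G \<open>e \<in> edges G\<close> unfolding simple_graph_def by blast
    have "\<phi> u \<noteq> \<phi> v" "\<phi> u \<in> I" "\<phi> v \<in> I" using phi uv by (auto simp: inj_on_def)
    then show ?thesis
      using zero[of "\<phi> u" "\<phi> v"] uv \<open>I \<subseteq> V\<close>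
      by (intro exI[of _ "[\<phi> u, \<phi> v]"]) (auto simp: path_inner_def)
  qed
  then obtain P where P: "\<And>e. e \<in> edges G \<Longrightarrow> distinct (P e) \<and> length (P e) = 2 \<and>
      {hd (P e), last (P e)} = \<phi> ` e \<and> path_inner (P e) = {} \<and> set (P e) \<subseteq> V \<and> int p dvd wt w (P e)"
    by metis
  have "zero_subdivision p w V G \<phi> P"
    unfolding zero_subdivision_def using P phi \<open>I \<subseteq> V\<close> by auto
  then show ?thesis by blast
qed

section \<open>Adding a pendant edge\<close>

text \<open>
  The list \<open>xs\<close> below collects the images of \<open>u\<close> in successive copies of \<open>G\<close>, newest first; the copy
  that belongs to an entry avoids all entries behind it.  Hence a zero-weight segment of \<open>xs\<close> meets the
  copy that belongs to its first entry only in that entry.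
\<close>

lemma forces_add_leaf:
  assumes G: "simple_graph G" and u: "u \<in> verts G" and v: "v \<notin> verts G" and p: "p > 0"
    and forces: "forces_zero_subdivision p TYPE('b) G f"
  shows "forces_zero_subdivision p TYPE('b) (add_edge u v (add_vertex v G)) (f + p)"
  unfolding forces_zero_subdivision_def
proof (intro allI impI)
  fix V :: "'b set" and w
  assume V: "finite V" "f + p \<le> card V"
  let ?rooted = "\<lambda>x B. \<exists>\<phi> P. zero_subdivision p w (V - set B) G \<phi> P \<and> \<phi> u = x"
  have "\<exists>xs. length xs = k \<and> distinct xs \<and> set xs \<subseteq> V \<and>
      (\<forall>A x B. xs = A @ x # B \<longrightarrow> ?rooted x B)" if "k \<le> Suc p" for k
    using that
  proof (induction k)
    case 0
    show ?case by simp
  next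
    case (Suc k)
    then obtain xs where xs: "length xs = k" "distinct xs" "set xs \<subseteq> V"
      "\<And>A x B. xs = A @ x # B \<Longrightarrow> ?rooted x B" by auto
    \<comment> \<open>At most \<open>p\<close> vertices are excluded so far, so one more copy fits.\<close>
    have "f \<le> card (V - set xs)"
      using V xs Suc.prems distinct_card[OF xs(2)] by (simp add: card_Diff_subset)
    then obtain \<phi> P where emb: "zero_subdivision p w (V - set xs) G \<phi> P"
      using forces V(1) unfolding forces_zero_subdivision_def by blast
    then have "\<phi> u \<in> V - set xs" using u by (auto simp: zero_subdivision_def)
    moreover have "?rooted x B" if "\<phi> u # xs = A @ x # B" for A x B
      using that emb xs(4) by (cases A) auto
    ultimately show ?case using xs by (intro exI[of _ "\<phi> u # xs"]) auto
  qed
  then obtain xs where xs: "length xs = Suc p" "distinct xs" "set xs \<subseteq> V"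
    "\<And>A x B. xs = A @ x # B \<Longrightarrow> ?rooted x B" by blast
  obtain A x B y C where seg: "xs = A @ x # B @ y # C" "int p dvd wt w (x # B @ [y])"
    using zero_weight_segment[of p xs w] p xs(1) by (metis lessI)
  obtain \<phi> P where emb: "zero_subdivision p w (V - set (B @ y # C)) G \<phi> P" "\<phi> u = x"
    using xs(4)[OF seg(1)] by blast
  let ?G = "add_vertex v G" and ?\<phi> = "\<phi>(v := y)"
  have "v \<noteq> u" using u v by blast
  have "zero_subdivision p w (insert y (V - set (B @ y # C))) ?G ?\<phi> P"
    using zero_subdivision_add_vertex[OF emb(1) G v] by simp
  moreover have "simple_graph ?G" using G by (rule simple_graph_add_vertex)
  ultimately have "\<exists>P'. zero_subdivision p w V (add_edge u v ?G) ?\<phi> P'"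
  proof (rule zero_subdivision_add_edge[where B = B])
    show "u \<in> verts ?G" "v \<in> verts ?G" using u by auto
    have "distinct (x # B @ y # C)" using xs(2) unfolding seg(1) by simp
    then show "distinct (?\<phi> u # B @ [?\<phi> v])" using emb(2) \<open>v \<noteq> u\<close> by auto
    show "int p dvd wt w (?\<phi> u # B @ [?\<phi> v])" using seg(2) emb(2) \<open>v \<noteq> u\<close> by simp
    show "set B \<inter> insert y (V - set (B @ y # C)) = {}"
      using \<open>distinct (x # B @ y # C)\<close> by auto
    have "set (B @ [y]) \<subseteq> V" using xs(3) unfolding seg(1) by auto
    then show "set B \<subseteq> V" "insert y (V - set (B @ y # C)) \<subseteq> V" by auto
  qed
  then show "\<exists>\<phi> P. zero_subdivision p w V (add_edge u v ?G) \<phi> P" by blast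
qed

section \<open>Flat vertex sets\<close>

text \<open>
  The elements of \<open>S\<close> are differences to a reference value, so \<open>two_valued p S\<close> says that \<open>S\<close> together
  with 0 represents at most two residues.

  In the following lemmas, for three vertices \<open>b, c, d\<close> and a fixed vertex \<open>y\<close>, the \<^emph>\<open>gain\<close> of \<open>(x, z)\<close>
  is the weight that the path from \<open>y\<close> over \<open>x\<close> to \<open>z\<close> has in excess of the edge from \<open>y\<close> to \<open>z\<close>.  The
  six gains are \<open>a = (b, d)\<close>, \<open>a' = (d, b)\<close>, \<open>s = (b, c)\<close>, \<open>s' = (c, b)\<close>, \<open>t = (c, d)\<close>,
  \<open>t' = (d, c)\<close>.  The sets \<open>D\<close>, \<open>B\<close>, \<open>C\<close> list the excess weights of all paths from \<open>y\<close> that end in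
  \<open>d\<close>, \<open>b\<close>, \<open>c\<close> and use only \<open>y, b, c, d\<close>.  The sum of two opposite gains is twice the weight of the edge
  between the two vertices, their difference is twice the difference of the weights of the edges
  to \<open>y\<close>; the latter yields the relation \<open>cocycle\<close>.
\<close>

definition two_valued :: "int \<Rightarrow> int set \<Rightarrow> bool" where
  "two_valued p S \<longleftrightarrow> (\<forall>u\<in>S. \<forall>v\<in>S. p dvd u \<or> p dvd v \<or> p dvd u - v)"

lemma two_valuedD: "two_valued p S \<Longrightarrow> u \<in> S \<Longrightarrow> v \<in> S \<Longrightarrow> p dvd u \<or> p dvd v \<or> p dvd u - v"
  by (auto simp: two_valued_def)

text \<open>
  Two nonzero gains between \<open>b\<close> and \<open>d\<close> whose sum is nonzero force the gains between \<open>b\<close> and \<open>c\<close> to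
  vanish.  The hypotheses are symmetric under exchanging \<open>b\<close> and \<open>d\<close>, which exchanges
  \<open>a, s, t\<close> with \<open>a', t', s'\<close>, so the same follows for the gains between \<open>c\<close> and \<open>d\<close>.
\<close>

lemma two_valued_triangle_half:
  fixes a a' s s' t t' p :: int
  assumes D: "two_valued p {a, t, s + t, s' + a}"
    and B: "two_valued p {a', s', t' + s', t + a'}"
    and C: "two_valued p {s, t', a + t', a' + s}"
    and nz: "\<not> p dvd a + a'" "\<not> p dvd a" "\<not> p dvd a'"
  shows "p dvd s' \<and> p dvd s"
proof
  show s': "p dvd s'"
  proof (rule ccontr)
    assume *: "\<not> p dvd s'"
    then have 1: "p dvd a' - s'" using two_valuedD[OF B, of a' s'] nz by auto
    have "p dvd a - (s' + a) \<Longrightarrow> p dvd s'" by simp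
    then have "p dvd s' + a" using two_valuedD[OF D, of a "s' + a"] nz * by auto
    with 1 have "p dvd a + a'" by algebra
    with nz show False by simp
  qed
  have t: "p dvd t"
  proof (rule ccontr)
    assume *: "\<not> p dvd t"
    then have 1: "p dvd a - t" using two_valuedD[OF D, of a t] nz by auto
    have "p dvd a' - (t + a') \<Longrightarrow> p dvd t" by simp
    then have "p dvd t + a'" using two_valuedD[OF B, of a' "t + a'"] nz * by auto
    with 1 have "p dvd a + a'" by algebra
    with nz show False by simp
  qed
  show "p dvd s"
  proof (rule ccontr)
    assume *: "\<not> p dvd s"
    with t have "\<not> p dvd s + t" by (simp add: dvd_add_left_iff)
    then have "p dvd a - (s + t)" using two_valuedD[OF D, of a "s + t"] nz by auto
    with t have 1: "p dvd a - s" by algebra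
    have "p dvd s - (a' + s) \<Longrightarrow> p dvd a'" by simp
    then have "p dvd a' + s" using two_valuedD[OF C, of s "a' + s"] nz * by auto
    with 1 have "p dvd a + a'" by algebra
    with nz show False by simp
  qed
qed

text \<open>
  Here the gain from \<open>d\<close> to \<open>b\<close> vanishes and the opposite one does not.  Then \<open>t\<close> is 0 or \<open>a\<close>, and
  in each case every alternative other than the two in the conclusion would make \<open>2 * a\<close> vanish.
\<close>

lemma two_valued_triangle_oneway:
  fixes a a' s s' t t' p :: int
  assumes D: "two_valued p {a, t, s + t, s' + a}"
    and B: "two_valued p {a', s', t' + s', t + a'}"
    and C: "two_valued p {s, t', a + t', a' + s}"
    and cocycle: "a - a' + t' - t + s' - s = 0"
    and odd: "\<not> p dvd 2 * a" and a': "p dvd a'"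
  shows "p dvd s \<and> p dvd s' \<or> p dvd t \<and> p dvd t'"
proof (cases "p dvd t")
  case t: True
  have a: "\<not> p dvd a" using odd dvd_mult by blast
  show ?thesis
  proof (cases "p dvd t'")
    case t': False
    have "p dvd t' - (a + t') \<Longrightarrow> p dvd a" by simp
    then have 1: "p dvd a + t'" using two_valuedD[OF C, of t' "a + t'"] a t' by auto
    have s': "p dvd s'"
    proof (rule ccontr)
      assume s': "\<not> p dvd s'"
      have "p dvd a - (s' + a) \<Longrightarrow> p dvd s'" by simp
      then have 2: "p dvd s' + a" using two_valuedD[OF D, of a "s' + a"] a s' by auto
      have "p dvd s' - (t' + s') \<Longrightarrow> p dvd t'" by simp
      then have 3: "p dvd t' + s'" using two_valuedD[OF B, of s' "t' + s'"] s' t' by auto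
      have "2 * a = (a + t') + (s' + a) - (t' + s')" by simp
      with 1 2 3 have "p dvd 2 * a" by (metis dvd_add dvd_diff)
      with odd show False by simp
    qed
    have "s = (a + t') - a' - t + s'" using cocycle by simp
    with 1 a' t s' have "p dvd s" by (metis dvd_add dvd_diff)
    with s' show ?thesis by simp
  qed (use t in simp)
next
  case t: False
  have a: "\<not> p dvd a" using odd dvd_mult by blast
  have at: "p dvd a - t" using two_valuedD[OF D, of a t] a t by auto
  have ta': "\<not> p dvd t + a'" using t a' by (simp add: dvd_add_left_iff)
  have s': "p dvd s'"
  proof (rule ccontr)
    assume s': "\<not> p dvd s'"
    then have "p dvd s' - (t + a')" using two_valuedD[OF B, of s' "t + a'"] ta' by auto
    then have 1: "p dvd s' - t" using a' by algebra
    have "p dvd a - (s' + a) \<Longrightarrow> p dvd s'" by simp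
    then have 2: "p dvd s' + a" using two_valuedD[OF D, of a "s' + a"] a s' by auto
    have "2 * a = (a - t) - (s' - t) + (s' + a)" by simp
    with 1 2 at have "p dvd 2 * a" by (metis dvd_add dvd_diff)
    with odd show False by simp
  qed
  have "p dvd s"
  proof (rule ccontr)
    assume s: "\<not> p dvd s"
    have 1: "p dvd s + t"
    proof (rule ccontr)
      assume "\<not> p dvd s + t"
      then have "p dvd t - (s + t)" using two_valuedD[OF D, of t "s + t"] t by auto
      with s show False by simp
    qed
    have "t' - s = a' - (a - t) - s'" using cocycle by simp
    then have t': "p dvd t' - s" using at a' s' by (metis dvd_diff)
    have "s = (t' + s') - (t' - s) - s'" by simp
    with s s' t' have "\<not> p dvd t' + s'" by (metis dvd_diff)
    then have 2: "p dvd (t' + s') - (t + a')" using two_valuedD[OF B, of "t' + s'" "t + a'"] ta' by auto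
    have "2 * a = 2 * (a - t) + (s + t) + (t' - s) + s' - a' - ((t' + s') - (t + a'))" by simp
    with 1 2 t' s' a' at have "p dvd 2 * a" by (metis dvd_add dvd_diff dvd_mult)
    with odd show False by simp
  qed
  with s' show ?thesis by simp
qed


text \<open>
  The two alternatives exclude each other: if the edges of the triangle at \<open>c\<close> both had weight 0, then
  the cocycle relation would make \<open>a\<close> twice a gain that \<open>D\<close> only allows to be 0 or \<open>a\<close> itself.  So
  \<open>c\<close> has an edge of nonzero weight to one of \<open>b\<close> and \<open>d\<close>, which \<open>flat_zero_clique\<close> uses to see
  that each of its two classes spans only zero edges.
\<close>

lemma two_valued_triangle_oneway_sharp:
  fixes a a' s s' t t' p :: int
  assumes D: "two_valued p {a, t, s + t, s' + a}"
    and B: "two_valued p {a', s', t' + s', t + a'}"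
    and C: "two_valued p {s, t', a + t', a' + s}"
    and cocycle: "a - a' + t' - t + s' - s = 0"
    and odd: "\<not> p dvd 2 * a" and a': "p dvd a'"
  shows "p dvd s \<and> p dvd s' \<and> \<not> p dvd t + t' \<or> p dvd t \<and> p dvd t' \<and> \<not> p dvd s + s'"
proof -
  have a: "\<not> p dvd a" using odd dvd_mult by blast
  have "\<not> p dvd t + t'" if s: "p dvd s" "p dvd s'"
  proof
    assume 1: "p dvd t + t'"
    have eq: "a = 2 * t + a' - (t + t') + s - s'" using cocycle by simp
    show False
    proof (cases "p dvd t")
      case True
      with eq 1 s a' have "p dvd a" by (metis dvd_add dvd_diff dvd_mult)
      with a show False by simp
    next
      case False
      then have 2: "p dvd a - t" using two_valuedD[OF D, of a t] a by auto
      have "a = 2 * (a - t) + (t + t') - a' + s' - s" using cocycle by simp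
      with 1 2 s a' have "p dvd a" by (metis dvd_add dvd_diff dvd_mult)
      with a show False by simp
    qed
  qed
  moreover have "\<not> p dvd s + s'" if t: "p dvd t" "p dvd t'"
  proof
    assume 1: "p dvd s + s'"
    have eq: "a = 2 * s + a' - (s + s') + t - t'" using cocycle by simp
    show False
    proof (cases "p dvd s")
      case True
      with eq 1 t a' have "p dvd a" by (metis dvd_add dvd_diff dvd_mult)
      with a show False by simp
    next
      case False
      then have "\<not> p dvd s + t" using t by (simp add: dvd_add_left_iff)
      then have 2: "p dvd a - (s + t)" using two_valuedD[OF D, of a "s + t"] a by auto
      have "a = 2 * (a - (s + t)) + (s + s') - a' + t + t'" using cocycle by simp
      with 1 2 t a' have "p dvd a" by (metis dvd_add dvd_diff dvd_mult)
      with a show False by simp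
    qed
  qed
  ultimately show ?thesis using two_valued_triangle_oneway[OF assms] by blast
qed

definition paths_in :: "'b set \<Rightarrow> 'b \<Rightarrow> 'b \<Rightarrow> 'b list set" where
  "paths_in X x y = {xs. xs \<noteq> [] \<and> distinct xs \<and> set xs \<subseteq> X \<and> hd xs = x \<and> last xs = y}"

definition path_residues :: "nat \<Rightarrow> ('b set \<Rightarrow> int) \<Rightarrow> 'b set \<Rightarrow> 'b \<Rightarrow> 'b \<Rightarrow> int set" where
  "path_residues p w X x y = (\<lambda>xs. wt w xs mod int p) ` paths_in X x y"

text \<open>
  Failure of the extension step that \<open>connector_or_flat\<close> uses to gain two residues at the price
  of three vertices.
\<close>

definition flat_at :: "nat \<Rightarrow> ('b set \<Rightarrow> int) \<Rightarrow> 'b \<Rightarrow> 'b set \<Rightarrow> bool" where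
  "flat_at p w y R \<longleftrightarrow>
     (\<forall>b\<in>R. \<forall>c\<in>R. \<forall>d\<in>R. distinct [b, c, d] \<longrightarrow> card (path_residues p w {y, b, c, d} y d) \<le> 2)"

lemma path_residues_subset: "p > 0 \<Longrightarrow> path_residues p w X x y \<subseteq> {0..<int p}"
  by (auto simp: path_residues_def)

lemma finite_path_residues: "p > 0 \<Longrightarrow> finite (path_residues p w X x y)"
  by (rule finite_subset[OF path_residues_subset]) auto

lemma two_valued_of_card_residues:
  assumes "p > 0" "card (path_residues p w X x y) \<le> 2"
    and "base \<in> paths_in X x y"
    and S: "\<And>u. u \<in> S \<Longrightarrow> \<exists>xs\<in>paths_in X x y. wt w xs = wt w base + u"
  shows "two_valued (int p) S"
  unfolding two_valued_def
proof (intro ballI, rule ccontr)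
  fix u v assume uv: "u \<in> S" "v \<in> S" "\<not> (int p dvd u \<or> int p dvd v \<or> int p dvd u - v)"
  let ?r = "\<lambda>u. (wt w base + u) mod int p"
  have ne: "?r i \<noteq> ?r j" if "\<not> int p dvd i - j" for i j
    using that by (simp add: mod_eq_dvd_iff)
  have zero_sub: "int p dvd i" if "int p dvd 0 - i" for i
    using that by simp
  have "?r 0 \<noteq> ?r u" "?r 0 \<noteq> ?r v" "?r u \<noteq> ?r v"
    using uv(3) ne zero_sub by blast+
  then have "card {?r 0, ?r u, ?r v} = 3" by simp
  moreover have "?r i \<in> path_residues p w X x y" if "i \<in> S" for i
    using S[OF that] by (force simp: path_residues_def)
  then have "{?r 0, ?r u, ?r v} \<subseteq> path_residues p w X x y"
    using assms(3) uv by (auto simp: path_residues_def)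
  ultimately have "3 \<le> card (path_residues p w X x y)"
    using card_mono[OF finite_path_residues[OF assms(1)]] by metis
  with assms(2) show False by simp
qed

text \<open>
  The five paths from \<open>y\<close> to \<open>d\<close> inside \<open>{y, b, c, d}\<close>, with the edge \<open>[y, d]\<close> as reference.
\<close>

lemma flat_at_two_valued:
  fixes w :: "'b set \<Rightarrow> int"
  defines "g \<equiv> \<lambda>y x z. w {y, x} + w {x, z} - w {y, z}"
  assumes "p > 0" "flat_at p w y R" "y \<notin> R" "b \<in> R" "c \<in> R" "d \<in> R" "distinct [b, c, d]"
  shows "two_valued (int p) {g y b d, g y c d, g y b c + g y c d, g y c b + g y b d}"
proof (rule two_valued_of_card_residues[where base = "[y, d]"])
  show "card (path_residues p w {y, b, c, d} y d) \<le> 2"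
    using assms unfolding flat_at_def by blast
  show "[y, d] \<in> paths_in {y, b, c, d} y d" using assms by (auto simp: paths_in_def)
  have "[y, b, d] \<in> paths_in {y, b, c, d} y d" "[y, c, d] \<in> paths_in {y, b, c, d} y d"
    "[y, b, c, d] \<in> paths_in {y, b, c, d} y d" "[y, c, b, d] \<in> paths_in {y, b, c, d} y d"
    using assms by (auto simp: paths_in_def)
  moreover have "wt w [y, b, d] = wt w [y, d] + g y b d" "wt w [y, c, d] = wt w [y, d] + g y c d"
    "wt w [y, b, c, d] = wt w [y, d] + (g y b c + g y c d)"
    "wt w [y, c, b, d] = wt w [y, d] + (g y c b + g y b d)"
    by (auto simp: g_def insert_commute)
  ultimately show "\<exists>xs\<in>paths_in {y, b, c, d} y d. wt w xs = wt w [y, d] + u"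
    if "u \<in> {g y b d, g y c d, g y b c + g y c d, g y c b + g y b d}" for u
    using that by blast
qed (use assms in auto)

text \<open>
  The shape of a triangle that contains an edge \<open>{b, d}\<close> of nonzero weight.  If \<open>b\<close> and \<open>d\<close> look
  alike from \<open>y\<close>, that edge is isolated among the edges of nonzero weight.  Otherwise the third vertex
  looks from \<open>y\<close> like one of the two, and it has a nonzero edge exactly to the other one.
\<close>

lemma flat_triangle:
  fixes w :: "'b set \<Rightarrow> int"
  assumes p: "p > 0" "odd p" and flat: "flat_at p w y R" "y \<notin> R"
    and bcd: "b \<in> R" "c \<in> R" "d \<in> R" "distinct [b, c, d]" and nz: "\<not> int p dvd w {b, d}"
  defines "\<alpha> \<equiv> \<lambda>x. w {y, x}"
  shows "int p dvd \<alpha> b - \<alpha> d \<and> int p dvd w {b, c} \<and> int p dvd w {c, d}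
    \<or> \<not> int p dvd \<alpha> b - \<alpha> d \<and> int p dvd w {b, c} \<and> int p dvd \<alpha> c - \<alpha> b \<and> \<not> int p dvd w {c, d}
    \<or> \<not> int p dvd \<alpha> b - \<alpha> d \<and> int p dvd w {c, d} \<and> int p dvd \<alpha> c - \<alpha> d \<and> \<not> int p dvd w {b, c}"
proof -
  \<comment> \<open>Here \<open>p\<close> being odd enters: weights are recovered from twice their value.\<close>
  have two: "int p dvd 2 * z \<longleftrightarrow> int p dvd z" for z :: int
    using p(2) by (simp add: coprime_dvd_mult_right_iff)
  define g where "g x z = \<alpha> x + w {x, z} - \<alpha> z" for x z
  have tv: "two_valued (int p) {g b d, g c d, g b c + g c d, g c b + g b d}"
    if "b \<in> R" "c \<in> R" "d \<in> R" "distinct [b, c, d]" for b c d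
    using flat_at_two_valued[OF p(1) flat that] by (simp add: g_def \<alpha>_def)
  have D: "two_valued (int p) {g b d, g c d, g b c + g c d, g c b + g b d}"
    using tv[of b c d] bcd by simp
  have B: "two_valued (int p) {g d b, g c b, g d c + g c b, g c d + g d b}"
    using tv[of d c b] bcd by auto
  have C: "two_valued (int p) {g b c, g d c, g b d + g d c, g d b + g b c}"
    using tv[of b d c] bcd by auto
  have C': "two_valued (int p) {g d c, g b c, g d b + g b c, g b d + g d c}"
    using C by (simp add: insert_commute)
  have cocycle: "g b d - g d b + g d c - g c d + g c b - g b c = 0"
    "g d b - g b d + g b c - g c b + g c d - g d c = 0"
    by (auto simp: g_def insert_commute)
  have sum: "int p dvd g x z + g z x \<longleftrightarrow> int p dvd w {x, z}" for x z
    using two[of "w {x, z}"] by (simp add: g_def insert_commute)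
  have diff: "int p dvd g x z - g z x \<longleftrightarrow> int p dvd \<alpha> x - \<alpha> z" for x z
    using two[of "\<alpha> x - \<alpha> z"] by (simp add: g_def insert_commute algebra_simps)
  have zero: "int p dvd w {x, z} \<and> int p dvd \<alpha> x - \<alpha> z" if "int p dvd g x z" "int p dvd g z x" for x z
    using that sum diff by (metis dvd_add dvd_diff)
  have bd: "\<not> int p dvd g b d + g d b" "\<not> int p dvd g d b + g b d"
    using nz sum[of b d] by (simp_all add: add.commute)
  consider "int p dvd g b d" "\<not> int p dvd g d b" | "\<not> int p dvd g b d" "int p dvd g d b"
    | "\<not> int p dvd g b d" "\<not> int p dvd g d b"
    using bd(1) by (meson dvd_add)
  then show ?thesis
  proof cases
    case 1
    then have "\<not> int p dvd \<alpha> d - \<alpha> b" using diff[of d b] by (metis diff_add_cancel dvd_add)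
    then have ne: "\<not> int p dvd \<alpha> b - \<alpha> d" by (metis dvd_diff_commute)
    have "\<not> int p dvd 2 * g d b" using 1 two by blast
    from two_valued_triangle_oneway_sharp[OF B D C' cocycle(2) this 1(1)]
    show ?thesis using zero[of d c] zero[of c d] zero[of b c] zero[of c b] sum[of b c] sum[of c d] ne
      by (auto simp: add.commute insert_commute)
  next
    case 2
    then have ne: "\<not> int p dvd \<alpha> b - \<alpha> d" using diff[of b d] by (metis diff_add_cancel dvd_add)
    have "\<not> int p dvd 2 * g b d" using 2 two by blast
    from two_valued_triangle_oneway_sharp[OF D B C cocycle(1) this 2(2)]
    show ?thesis using zero[of d c] zero[of c d] zero[of b c] zero[of c b] sum[of b c] sum[of c d] ne
      by (auto simp: add.commute insert_commute)
  next
    case 3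
    from two_valued_triangle_half[OF D B C bd(1) 3]
    have s: "int p dvd g c b" "int p dvd g b c" by auto
    from two_valued_triangle_half[OF B D C' bd(2) 3(2,1)]
    have t: "int p dvd g c d" "int p dvd g d c" by auto
    have "g b d - g d b = g c d - g d c - g c b + g b c" using cocycle by simp
    with s t have "int p dvd g b d - g d b" by (metis dvd_add dvd_diff)
    then show ?thesis using diff zero[OF s(2,1)] zero[OF t] by blast
  qed
qed

text \<open>
  Remove a matching edge, apply induction, and put one of its ends back.
\<close>

lemma matching_independent_half:
  assumes "finite R" and sym: "\<And>x y. E x y \<Longrightarrow> E y x"
    and matching: "\<And>x y z. x \<in> R \<Longrightarrow> y \<in> R \<Longrightarrow> z \<in> R \<Longrightarrow> x \<noteq> y \<Longrightarrow> x \<noteq> z \<Longrightarrow> E x y \<Longrightarrow> E x z \<Longrightarrow> y = z"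
  shows "\<exists>I\<subseteq>R. card R \<le> 2 * card I \<and> (\<forall>x\<in>I. \<forall>y\<in>I. x \<noteq> y \<longrightarrow> \<not> E x y)"
proof -
  have "\<forall>x\<in>R. \<forall>y\<in>R. \<forall>z\<in>R. x \<noteq> y \<longrightarrow> x \<noteq> z \<longrightarrow> E x y \<longrightarrow> E x z \<longrightarrow> y = z"
    using matching by blast
  with \<open>finite R\<close> show ?thesis
  proof (induction R rule: finite_psubset_induct)
    case (psubset R)
    show ?case
    proof (cases "\<exists>x\<in>R. \<exists>y\<in>R. x \<noteq> y \<and> E x y")
      case False
      then show ?thesis by (intro exI[of _ R]) auto
    next
      case True
      then obtain x y where xy: "x \<in> R" "y \<in> R" "x \<noteq> y" "E x y" by blast
      have "R - {x, y} \<subset> R" using xy by blast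
      moreover have "\<forall>a\<in>R - {x, y}. \<forall>b\<in>R - {x, y}. \<forall>c\<in>R - {x, y}.
          a \<noteq> b \<longrightarrow> a \<noteq> c \<longrightarrow> E a b \<longrightarrow> E a c \<longrightarrow> b = c"
        using psubset.prems by fast
      ultimately obtain I where I: "I \<subseteq> R - {x, y}" "card (R - {x, y}) \<le> 2 * card I"
        "\<forall>a\<in>I. \<forall>b\<in>I. a \<noteq> b \<longrightarrow> \<not> E a b"
        using psubset.IH[of "R - {x, y}"] by blast
      have "finite I" using I(1) psubset.hyps by (meson finite_Diff finite_subset)
      moreover have "x \<notin> I" using I(1) by blast
      ultimately have "card (insert x I) = Suc (card I)" by simp
      moreover have "card (R - {x, y}) = card R - 2"
        using xy psubset.hyps by (simp add: card_Diff_subset)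
      ultimately have "card R \<le> 2 * card (insert x I)" using I(2) by simp
      moreover have "\<not> E x z" "\<not> E z x" if "z \<in> I" for z
      proof -
        have z: "z \<in> R" "z \<noteq> x" "z \<noteq> y" using that I(1) by auto
        then show "\<not> E x z" using psubset.prems xy by metis
        then show "\<not> E z x" using sym by blast
      qed
      ultimately show ?thesis using I xy(1) by (intro exI[of _ "insert x I"]) auto
    qed
  qed
qed

text \<open>
  If some edge of nonzero weight has ends that look different from \<open>y\<close>, every vertex of \<open>R\<close> looks like
  one of these ends, and each of the two classes spans only zero edges; the larger class will do.
  Otherwise the edges of nonzero weight form a matching.
\<close>

lemma flat_zero_clique:
  assumes p: "p > 0" "odd p" and flat: "flat_at p w y R" "y \<notin> R" and "finite R"
  shows "\<exists>I\<subseteq>R. card R \<le> 2 * card I \<and> (\<forall>x\<in>I. \<forall>z\<in>I. x \<noteq> z \<longrightarrow> int p dvd w {x, z})"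
proof (cases "\<exists>b\<in>R. \<exists>d\<in>R. b \<noteq> d \<and> \<not> int p dvd w {b, d} \<and> \<not> int p dvd w {y, b} - w {y, d}")
  case True
  note tri = flat_triangle[OF p flat]
  let ?cls = "\<lambda>b. {x \<in> R. int p dvd w {y, x} - w {y, b}}"
  have cls: "int p dvd w {x, z}"
    if bd: "b \<in> R" "d \<in> R" "\<not> int p dvd w {b, d}" "\<not> int p dvd w {y, b} - w {y, d}"
      and xz: "x \<in> ?cls b" "z \<in> ?cls b" "x \<noteq> z" for b d x z
  proof -
    have ne: "\<not> int p dvd w {y, u} - w {y, d}" "u \<noteq> d" if "u \<in> ?cls b" for u
    proof -
      show "\<not> int p dvd w {y, u} - w {y, d}"
      proof
        assume "int p dvd w {y, u} - w {y, d}"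
        moreover have "int p dvd w {y, u} - w {y, b}" using that by simp
        ultimately have "int p dvd w {y, b} - w {y, d}" by algebra
        with bd show False by simp
      qed
      then show "u \<noteq> d" by auto
    qed
    have xd: "\<not> int p dvd w {x, d}"
    proof (cases "x = b")
      case False
      then show ?thesis using tri[of b x d] bd ne[OF xz(1)] xz(1) by auto
    qed (use bd in simp)
    then show ?thesis
      using tri[of x z d] bd ne[OF xz(1)] ne[OF xz(2)] xz by auto
  qed
  from True obtain b d where bd: "b \<in> R" "d \<in> R" "b \<noteq> d" "\<not> int p dvd w {b, d}"
    "\<not> int p dvd w {y, b} - w {y, d}" by blast
  then have db: "\<not> int p dvd w {d, b}" "\<not> int p dvd w {y, d} - w {y, b}"
    by (simp_all add: insert_commute dvd_diff_commute)
  have "R \<subseteq> ?cls b \<union> ?cls d"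
  proof
    fix x assume "x \<in> R"
    then show "x \<in> ?cls b \<union> ?cls d" using tri[of b x d] bd by (cases "x = b \<or> x = d") auto
  qed
  then have "card R \<le> card (?cls b \<union> ?cls d)" using \<open>finite R\<close> by (intro card_mono) auto
  also have "\<dots> \<le> card (?cls b) + card (?cls d)" by (rule card_Un_le)
  finally consider "card R \<le> 2 * card (?cls b)" | "card R \<le> 2 * card (?cls d)" by linarith
  then show ?thesis
  proof cases
    case 1
    then show ?thesis using cls[OF bd(1,2,4,5)] by (intro exI[of _ "?cls b"]) auto
  next
    case 2
    then show ?thesis using cls[OF bd(2,1) db] by (intro exI[of _ "?cls d"]) auto
  qed
next
  case False
  have "\<exists>I\<subseteq>R. card R \<le> 2 * card I \<and> (\<forall>x\<in>I. \<forall>z\<in>I. x \<noteq> z \<longrightarrow> \<not> \<not> int p dvd w {x, z})"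
  proof (rule matching_independent_half[OF \<open>finite R\<close>])
    fix x u z assume *: "x \<in> R" "u \<in> R" "z \<in> R" "x \<noteq> u" "x \<noteq> z"
      "\<not> int p dvd w {x, u}" "\<not> int p dvd w {x, z}"
    show "u = z"
    proof (rule ccontr)
      assume "u \<noteq> z"
      then show False using flat_triangle[OF p flat, of x z u] False * by auto
    qed
  qed (simp add: insert_commute)
  then show ?thesis by simp
qed

section \<open>Connectors\<close>

text \<open>
  Two paths that can only meet in \<open>y\<close> concatenate to a path.
\<close>

lemma path_residues_join:
  assumes XY: "X \<inter> Y \<subseteq> {y}"
  shows "sumset_mod p (path_residues p w X x y) (path_residues p w Y y z) \<subseteq> path_residues p w (X \<union> Y) x z"
proof
  fix r assume "r \<in> sumset_mod p (path_residues p w X x y) (path_residues p w Y y z)"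
  then obtain xs ys where xs: "xs \<in> paths_in X x y" and ys: "ys \<in> paths_in Y y z"
    and r: "r = (wt w xs mod int p + wt w ys mod int p) mod int p"
    by (auto simp: path_residues_def)
  obtain zs where zs: "ys = y # zs" using ys by (cases ys) (auto simp: paths_in_def)
  have "set xs \<inter> set zs = {}" using xs ys zs XY by (auto simp: paths_in_def)
  then have "xs @ tl ys \<in> paths_in (X \<union> Y) x z"
    using xs ys zs by (auto simp: paths_in_def)
  moreover have "r = wt w (xs @ tl ys) mod int p"
    using xs ys r by (subst wt_append_tl) (auto simp: paths_in_def mod_simps)
  ultimately show "r \<in> path_residues p w (X \<union> Y) x z" by (auto simp: path_residues_def)
qed

text \<open>
  Each extension adds a set of at least three residues, hence two new residues by the Cauchy-Davenport
  theorem, until all \<open>p\<close> are reached.  Consecutive pieces share an end, so that a piece on four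
  vertices costs only three.
\<close>

lemma connector_or_flat:
  assumes "prime p" "finite V" "V \<noteq> {}"
  shows "(\<exists>X x y. X \<subseteq> V \<and> card X = 3 * k + 1 \<and> min p (2 * k + 1) \<le> card (path_residues p w X x y))
    \<or> (\<exists>j<k. \<exists>X y. X \<subseteq> V \<and> card X = 3 * j + 1 \<and> y \<in> X \<and> flat_at p w y (V - X))"
proof (induction k)
  case 0
  obtain v where v: "v \<in> V" using assms(3) by blast
  have "[v] \<in> paths_in {v} v v" by (simp add: paths_in_def)
  then have "path_residues p w {v} v v \<noteq> {}" by (auto simp: path_residues_def)
  moreover have p0: "p > 0" using assms(1) by (rule prime_gt_0_nat)
  ultimately have "1 \<le> card (path_residues p w {v} v v)"
    using finite_path_residues[OF p0, of w "{v}" v v] by (metis One_nat_def Suc_leI card_gt_0_iff)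
  then show ?case using v by (intro disjI1 exI[of _ "{v}"] exI[of _ v]) auto
next
  case (Suc k)
  have p0: "p > 0" using assms(1) by (rule prime_gt_0_nat)
  from Suc consider X x y where "X \<subseteq> V" "card X = 3 * k + 1"
      "min p (2 * k + 1) \<le> card (path_residues p w X x y)"
    | "\<exists>j<k. \<exists>X y. X \<subseteq> V \<and> card X = 3 * j + 1 \<and> y \<in> X \<and> flat_at p w y (V - X)"
    by blast
  then show ?case
  proof cases
    case (1 X x y)
    have finX: "finite X" using 1(1) assms(2) by (rule finite_subset)
    have "path_residues p w X x y \<noteq> {}" using 1(3) p0 by auto
    then have "y \<in> X" by (auto simp: path_residues_def paths_in_def)
    show ?thesis
    proof (cases "flat_at p w y (V - X)")
      case True
      then show ?thesis using 1 \<open>y \<in> X\<close> by (intro disjI2 exI[of _ k]) auto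
    next
      case False
      then obtain b c d where bcd: "b \<in> V - X" "c \<in> V - X" "d \<in> V - X" "distinct [b, c, d]"
        "\<not> card (path_residues p w {y, b, c, d} y d) \<le> 2"
        unfolding flat_at_def by blast
      define Y where "Y = {y, b, c, d}"
      have "X \<union> Y = X \<union> {b, c, d}" using \<open>y \<in> X\<close> by (auto simp: Y_def)
      moreover have "card (X \<union> {b, c, d}) = card X + 3"
        using bcd finX by (subst card_Un_disjoint) auto
      ultimately have card: "card (X \<union> Y) = 3 * Suc k + 1" using 1(2) by simp
      have 3: "3 \<le> card (path_residues p w Y y d)" using bcd by (simp add: Y_def)
      have "min p (2 * Suc k + 1)
          \<le> min p (card (path_residues p w X x y) + card (path_residues p w Y y d) - 1)"
        using 1(3) 3 by (auto simp: min_def split: if_splits)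
      also have "\<dots> \<le> card (sumset_mod p (path_residues p w X x y) (path_residues p w Y y d))"
        using 3 by (intro Cauchy_Davenport assms(1) path_residues_subset p0 \<open>path_residues p w X x y \<noteq> {}\<close>) auto
      also have "\<dots> \<le> card (path_residues p w (X \<union> Y) x d)"
        using bcd by (intro card_mono finite_path_residues p0 path_residues_join) (auto simp: Y_def)
      finally show ?thesis using card 1(1) bcd \<open>y \<in> X\<close>
        by (intro disjI1 exI[of _ "X \<union> Y"] exI[of _ x] exI[of _ d]) (auto simp: Y_def)
    qed
  next
    case 2
    then show ?thesis using less_Suc_eq by blast
  qed
qed

section \<open>Adding an edge between existing vertices\<close>

lemma wt_bracket:
  assumes "xs \<noteq> []"
  shows "wt w (a # xs @ [b]) = w {a, hd xs} + wt w xs + w {last xs, b}"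
proof -
  have "wt w (xs @ [b]) = wt w xs + w {last xs, b}"
    using assms by (induction w xs rule: wt.induct) auto
  then show ?thesis using assms by (cases xs) auto
qed

text \<open>
  The assumption \<open>3 * card (verts G) \<le> f + 2\<close> is used when the growth of the connector gets stuck:
  at least \<open>f + 3\<close> vertices are left then, and half of them have to accommodate all vertices of
  \<open>G\<close>.
\<close>

lemma forces_add_edge:
  assumes p: "prime p" "p = 2 * c + 1" and G: "simple_graph G"
    and uv: "u \<in> verts G" "v \<in> verts G" "u \<noteq> v"
    and forces: "forces_zero_subdivision p TYPE('b) G f" and f: "3 * card (verts G) \<le> f + 2"
  shows "forces_zero_subdivision p TYPE('b) (add_edge u v G) (f + p + c)"
  unfolding forces_zero_subdivision_def
proof (intro allI impI)
  fix V :: "'b set" and w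
  assume V: "finite V" "f + p + c \<le> card V"
  have p0: "p > 0" using p(1) by (rule prime_gt_0_nat)
  have "V \<noteq> {}" using V p(2) by auto
  from connector_or_flat[OF p(1) V(1) this, of c w]
  consider X x y where "X \<subseteq> V" "card X = 3 * c + 1" "min p (2 * c + 1) \<le> card (path_residues p w X x y)"
    | j X y where "j < c" "X \<subseteq> V" "card X = 3 * j + 1" "y \<in> X" "flat_at p w y (V - X)"
    by blast
  then show "\<exists>\<phi> P. zero_subdivision p w V (add_edge u v G) \<phi> P"
  proof cases
    case (1 X x y)
    have all: "path_residues p w X x y = {0..<int p}"
    proof (rule card_seteq)
      show "card {0..<int p} \<le> card (path_residues p w X x y)" using 1(3) p(2) by simp
    qed (use path_residues_subset[OF p0, of w X x y] in auto)
    have "f \<le> card (V - X)"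
      using 1 V p(2) by (simp add: card_Diff_subset finite_subset)
    then obtain \<phi> P where emb: "zero_subdivision p w (V - X) G \<phi> P"
      using forces V(1) unfolding forces_zero_subdivision_def by blast
    \<comment> \<open>The connector has to compensate the edges that lead into it and out of it.\<close>
    have "(- (w {\<phi> u, x} + w {y, \<phi> v})) mod int p \<in> path_residues p w X x y"
      unfolding all using p0 by simp
    then obtain xs where xs: "xs \<in> paths_in X x y"
      "(- (w {\<phi> u, x} + w {y, \<phi> v})) mod int p = wt w xs mod int p"
      unfolding path_residues_def image_iff by blast
    have "int p dvd wt w xs + (w {\<phi> u, x} + w {y, \<phi> v})"
      using xs(2)[symmetric] by (simp add: mod_eq_dvd_iff algebra_simps)
    then have "int p dvd wt w (\<phi> u # xs @ [\<phi> v])"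
      using xs(1) by (subst wt_bracket) (auto simp: paths_in_def algebra_simps)
    moreover have "\<phi> u \<in> V - X" "\<phi> v \<in> V - X" "\<phi> u \<noteq> \<phi> v"
      using emb uv by (auto simp: zero_subdivision_def inj_on_def)
    then have "distinct (\<phi> u # xs @ [\<phi> v])" using xs(1) by (auto simp: paths_in_def)
    moreover have "set xs \<inter> (V - X) = {}" "set xs \<subseteq> V" using xs(1) 1(1) by (auto simp: paths_in_def)
    ultimately show ?thesis using zero_subdivision_add_edge[OF emb G uv(1,2)] by blast
  next
    case (2 j X y)
    have "card (V - X) = card V - card X" using 2 V(1) by (simp add: card_Diff_subset finite_subset)
    then have big: "3 * card (verts G) + 1 \<le> card (V - X)" using 2 V f p(2) by simp
    have "odd p" using p(2) by simp
    then obtain I where I: "I \<subseteq> V - X" "card (V - X) \<le> 2 * card I"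
      "\<forall>x\<in>I. \<forall>z\<in>I. x \<noteq> z \<longrightarrow> int p dvd w {x, z}"
      using flat_zero_clique[OF p0 _ 2(5)] 2(4) V(1) by auto
    have "simple_graph (add_edge u v G)" using G uv unfolding simple_graph_def by auto
    moreover have "finite I" using I(1) V(1) by (meson finite_Diff finite_subset)
    moreover have "card (verts (add_edge u v G)) \<le> card I" using I(2) big by simp
    ultimately show ?thesis using I by (intro zero_subdivision_of_zero_clique[where I = I]) auto
  qed
qed

section \<open>Building up a connected graph\<close>

lemma path_edges_subset_ConsD: "path_edges (x # y # xs) \<subseteq> E \<Longrightarrow> {x, y} \<in> E \<and> path_edges (y # xs) \<subseteq> E"
  by (simp add: path_edges_Cons)

lemma path_stays_in_closed_set:
  assumes "path_edges xs \<subseteq> E" "xs \<noteq> []" "hd xs \<in> S"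
    and "\<And>a b. {a, b} \<in> E \<Longrightarrow> a \<in> S \<Longrightarrow> b \<in> S"
  shows "last xs \<in> S"
  using assms(1-3)
proof (induction xs rule: induct_list012)
  case (3 x y zs)
  then show ?case using assms(4)[of x y] by (auto dest: path_edges_subset_ConsD)
qed auto

text \<open>
  Take a largest subgraph of \<open>H\<close> that can be built by the three rules.  An edge of \<open>H\<close> that touches it
  without belonging to it would allow one more step, so by connectedness it is all of \<open>H\<close>.
\<close>

lemma connected_graph_induct [consumes 2, case_names single leaf edge]:
  fixes H :: "'a ugraph"
  assumes H: "simple_graph H" "connected_graph H"
    and single: "\<And>v. Q \<lparr>verts = {v}, edges = {}\<rparr>"
    and leaf: "\<And>G u v. simple_graph G \<Longrightarrow> Q G \<Longrightarrow> u \<in> verts G \<Longrightarrow> v \<notin> verts G \<Longrightarrow>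
      Q (add_edge u v (add_vertex v G))"
    and edge: "\<And>G u v. simple_graph G \<Longrightarrow> Q G \<Longrightarrow> u \<in> verts G \<Longrightarrow> v \<in> verts G \<Longrightarrow> u \<noteq> v \<Longrightarrow>
      {u, v} \<notin> edges G \<Longrightarrow> Q (add_edge u v G)"
  shows "Q H"
proof -
  let ?good = "\<lambda>G :: 'a ugraph. simple_graph G \<and> Q G \<and> verts G \<noteq> {} \<and> verts G \<subseteq> verts H \<and> edges G \<subseteq> edges H"
  let ?size = "\<lambda>G :: 'a ugraph. card (verts G) + card (edges G)"
  have finV: "finite (verts H)" using H(1) by (simp add: simple_graph_def)
  have "edges H \<subseteq> Pow (verts H)" using H(1) by (auto simp: simple_graph_def)
  then have finE: "finite (edges H)" using finV by (simp add: finite_subset)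
  obtain v0 where v0: "v0 \<in> verts H" using H(2) by (auto simp: connected_graph_def)
  have "?good \<lparr>verts = {v0}, edges = {}\<rparr>" using v0 single by (simp add: simple_graph_def)
  moreover have "\<forall>G. ?good G \<longrightarrow> ?size G < Suc (?size H)"
    using finV finE by (auto simp: less_Suc_eq_le intro!: add_mono card_mono)
  ultimately obtain G where G: "?good G" and max: "\<And>G'. ?good G' \<Longrightarrow> ?size G' \<le> ?size G"
    using ex_has_greatest_nat[of ?good "\<lparr>verts = {v0}, edges = {}\<rparr>" ?size "Suc (?size H)"] by metis
  have fin: "finite (verts G)" "finite (edges G)" using G finV finE by (blast intro: finite_subset)+
  have closed: "b \<in> verts G \<and> {a, b} \<in> edges G" if ab: "{a, b} \<in> edges H" "a \<in> verts G" for a b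
  proof -
    have b: "b \<in> verts H" "a \<noteq> b"
      using ab(1) H(1) unfolding simple_graph_def by (auto simp: doubleton_eq_iff)
    have "b \<in> verts G"
    proof (rule ccontr)
      assume nb: "b \<notin> verts G"
      let ?G = "add_edge a b (add_vertex b G)"
      have "simple_graph ?G"
        using simple_graph_add_vertex[of G b] G ab(2) b(2) unfolding simple_graph_def by auto
      moreover have "Q ?G" using leaf G ab(2) nb by blast
      ultimately have "?good ?G" using G ab b by simp
      from max[OF this] have "Suc (card (verts G)) + card (insert {a, b} (edges G)) \<le> ?size G"
        using fin nb by simp
      moreover have "card (edges G) \<le> card (insert {a, b} (edges G))" using fin by (intro card_mono) auto
      ultimately show False by simp
    qed
    moreover have "{a, b} \<in> edges G"
    proof (rule ccontr)
      assume nab: "{a, b} \<notin> edges G"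
      let ?G = "add_edge a b G"
      have "simple_graph ?G" using G ab(2) b(2) \<open>b \<in> verts G\<close> unfolding simple_graph_def by auto
      moreover have "Q ?G" using edge G ab(2) \<open>b \<in> verts G\<close> b(2) nab by blast
      ultimately have "?good ?G" using G ab b by simp
      from max[OF this] show False using fin nab by simp
    qed
    ultimately show ?thesis by simp
  qed
  have "verts H \<subseteq> verts G"
  proof
    fix b assume b: "b \<in> verts H"
    obtain a where a: "a \<in> verts G" "a \<in> verts H" using G by blast
    then obtain xs where xs: "path_in H xs" "hd xs = a" "last xs = b"
      using H(2) b unfolding connected_graph_def by blast
    show "b \<in> verts G"
      using path_stays_in_closed_set[of xs "edges H" "verts G"] xs a(1) closed by (auto simp: path_in_def)
  qed
  then have V: "verts G = verts H" using G by blast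
  moreover have "edges H \<subseteq> edges G"
  proof
    fix e assume "e \<in> edges H"
    then obtain a b where "a \<in> verts H" "e = {a, b}" using H(1) unfolding simple_graph_def by blast
    with \<open>e \<in> edges H\<close> show "e \<in> edges G" using closed[of a b] V by simp
  qed
  then have "edges G = edges H" using G by blast
  ultimately have "G = H" by simp
  then show ?thesis using G by simp
qed

text \<open>
  The equation for \<open>f\<close> is the claimed bound without subtraction and division.  The inequality, which
  \<open>forces_add_edge\<close> needs, is preserved because a new vertex costs \<open>p \<ge> 3\<close>.
\<close>

lemma connected_graph_forces:
  fixes H :: "'a ugraph"
  assumes H: "simple_graph H" "connected_graph H" and p: "prime p" "p = 2 * c + 1" "p \<ge> 3"
  shows "\<exists>f. forces_zero_subdivision p TYPE('b) H f \<and>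
    f + c * card (verts H) = (p + c) * card (edges H) + c + 1 \<and> 3 * card (verts H) \<le> f + 2"
  using H
proof (induction H rule: connected_graph_induct)
  case (single v)
  have "\<exists>\<phi> P. zero_subdivision p w V \<lparr>verts = {v}, edges = {}\<rparr> \<phi> P"
    if "1 \<le> card V" for V :: "'b set" and w
  proof -
    obtain z where "z \<in> V" using \<open>1 \<le> card V\<close> by fastforce
    then show ?thesis by (auto simp: zero_subdivision_def)
  qed
  then show ?case by (intro exI[of _ 1]) (simp add: forces_zero_subdivision_def)
next
  case (leaf G u v)
  from leaf.IH obtain f where f: "forces_zero_subdivision p TYPE('b) G f"
    "f + c * card (verts G) = (p + c) * card (edges G) + c + 1" "3 * card (verts G) \<le> f + 2" by blast
  have "finite (verts G)" "\<forall>e\<in>edges G. e \<subseteq> verts G" using leaf.hyps(1) by (auto simp: simple_graph_def)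
  moreover from this have "finite (edges G)" by (metis PowI finite_Pow_iff finite_subset subsetI)
  moreover from calculation have "{u, v} \<notin> edges G" using leaf.hyps(3) by blast
  ultimately have "card (verts (add_edge u v (add_vertex v G))) = Suc (card (verts G))"
    "card (edges (add_edge u v (add_vertex v G))) = Suc (card (edges G))" using leaf.hyps(3) by auto
  with f p forces_add_leaf[OF leaf.hyps _ f(1)] show ?case
    by (intro exI[of _ "f + p"]) (simp add: algebra_simps)
next
  case (edge G u v)
  from edge.IH obtain f where f: "forces_zero_subdivision p TYPE('b) G f"
    "f + c * card (verts G) = (p + c) * card (edges G) + c + 1" "3 * card (verts G) \<le> f + 2" by blast
  have "finite (verts G)" "\<forall>e\<in>edges G. e \<subseteq> verts G" using edge.hyps(1) by (auto simp: simple_graph_def)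
  then have "finite (edges G)" by (metis PowI finite_Pow_iff finite_subset subsetI)
  then have "card (edges (add_edge u v G)) = Suc (card (edges G))" using edge.hyps(5) by simp
  with f p forces_add_edge[OF p(1,2) edge.hyps(1-4) f(1,3)] show ?case
    by (intro exI[of _ "f + p + c"]) (simp add: algebra_simps)
qed

section \<open>The bound\<close>

text \<open>
  Paths with distinct vertices never repeat an edge, so summing over the edge set agrees with summing
  along the list.
\<close>

lemma forces_divisible_of_zero_subdivision:
  assumes "forces_zero_subdivision p TYPE(nat) H f"
  shows "forces_divisible_subdivision p H f"
  unfolding forces_divisible_subdivision_def
proof
  fix \<omega> assume w: "\<omega> \<in> edges (K f) \<rightarrow> carrier (integer_mod_group p)"
  obtain \<phi> P where emb: "zero_subdivision p \<omega> {..<f} H \<phi> P"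
    using assms by (force simp: forces_zero_subdivision_def)
  let ?S = "\<lparr>verts = \<phi> ` verts H \<union> (\<Union>e\<in>edges H. set (P e)),
    edges = \<Union>e\<in>edges H. path_edges (P e)\<rparr>"
  have edgesK: "path_edges (P e) \<subseteq> edges (K f)" if "e \<in> edges H" for e
  proof
    fix d assume "d \<in> path_edges (P e)"
    then have "\<exists>u\<in>set (P e). \<exists>v\<in>set (P e). u \<noteq> v \<and> d = {u, v}"
      using emb that by (intro path_edges_doubleton) (auto simp: zero_subdivision_def)
    moreover have "set (P e) \<subseteq> {..<f}" using emb that by (simp add: zero_subdivision_def)
    ultimately show "d \<in> edges (K f)" unfolding K_def ugraph.simps by blast
  qed
  have "subgraph_of ?S (K f)"
    using emb edgesK by (auto simp: subgraph_of_def zero_subdivision_def K_def)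
  moreover have "subdivision_via H ?S \<phi> P"
    using emb by (simp add: subdivision_via_def zero_subdivision_def)
  moreover have "path_weight p \<omega> (P e) = 0" if "e \<in> edges H" for e
  proof -
    have "\<omega> \<in> path_edges (P e) \<rightarrow> carrier (integer_mod_group p)" using w edgesK[OF that] by blast
    then have "path_weight p \<omega> (P e) = wt \<omega> (P e) mod int p"
      using emb that by (simp add: path_weight_eq_sum_mod sum_path_edges zero_subdivision_def)
    then show ?thesis using emb that by (simp add: zero_subdivision_def)
  qed
  ultimately show "\<exists>S. subgraph_of S (K f) \<and> divisible_subdivision p H \<omega> S"
    unfolding divisible_subdivision_def by blast
qed

theorem theorem1p7:
  fixes H :: "'a ugraph" and n m p :: nat
  assumes "simple_graph H"
    and "connected_graph H"
    and "card (verts H) = n"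
    and "card (edges H) = m"
    and "prime p"
    and "p \<ge> 3"
  shows "ereal_of_enat (s_q p H)
           \<le> ereal ((3 * real p - 1) / 2 * real m - (real p - 1) / 2 * real n + (real p + 1) / 2)"
proof -
  have "odd p" using assms(5,6) prime_odd_nat by auto
  then obtain c where c: "p = 2 * c + 1" by (rule oddE)
  obtain f where f: "forces_zero_subdivision p TYPE(nat) H f" "f + c * n = (p + c) * m + c + 1"
    using connected_graph_forces[OF assms(1,2,5) c assms(6)] assms(3,4) by blast
  have "s_q p H \<le> enat f"
    unfolding s_q_def using forces_divisible_of_zero_subdivision[OF f(1)] by (intro INF_lower) simp
  then have "ereal_of_enat (s_q p H) \<le> ereal_of_enat (enat f)" by (simp only: ereal_of_enat_le_iff)
  also have "\<dots> = ereal (real f)" by simp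
  also have "real f = (3 * real p - 1) / 2 * real m - (real p - 1) / 2 * real n + (real p + 1) / 2"
  proof -
    have "real f + real c * real n = (real p + real c) * real m + real c + 1"
      using f(2) by (metis of_nat_1 of_nat_add of_nat_mult)
    moreover have "real p = 2 * real c + 1" using c by simp
    ultimately show ?thesis by (simp add: field_simps)
  qed
  finally show ?thesis .
qed

end
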